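(* Let $L$ be a number field of degree $n$ with a Hopf-Galois structure $H$, let $\mathcal{O}$ be a $\mathbb{Z}$-order in $L$, let $W=\{w_i\}_{i=1}^n$ be a $\mathbb{Q}$-basis of $H$ and let $B=\{\gamma_j\}_{j=1}^n$ be a $\mathbb{Z}$-basis of $\mathcal{O}$. Let $D$ be a reduced matrix of $M(H_W,L_B)$ and write $D^{-1}=(d_{ij})_{i,j=1}^n$. Then the elements $$v_i=\sum_{l=1}^n d_{li}w_l,\qquad 1\le i\le n,$$ form a $\mathbb{Z}$-basis of $\mathfrak{A}_H(\mathcal{O})$.
   Context: A Hopf-Galois structure on a number field $L$ is a finite-dimensional cocommutative $\mathbb{Q}$-Hopf algebra $H$ with a $\mathbb{Q}$-linear action $\cdot\colon H\otimes_{\mathbb{Q}}L\to L$ making $L$ an $H$-module algebra and such that $L\otimes_{\mathbb{Q}}H\to\mathrm{End}_{\mathbb{Q}}(L)$, $x\otimes h\mapsto (y\mapsto x(h\cdot y))$, is a $\mathbb{Q}$-linear isomorphism. A $\mathbb{Z}$-order in $L$ is a unital subring that is finitely generated over $\mathbb{Z}$ and contains a $\mathbb{Q}$-basis of $L$. The associated order is $\mathfrak{A}_H(\mathcal{O})=\{h\in H\mid h\cdot\mathcal{O}\subseteq\mathcal{O}\}$. For $1\le j\le n$, $M_j(H_W,L_B)\in\mathcal{M}_n(\mathbb{Q})$ is the matrix whose $i$-th column is the coordinate vector of $w_i\cdot\gamma_j$ with respect to $B$. The matrix $M(H_W,L_B)\in\mathcal{M}_{n^2\times n}(\mathbb{Q})$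 is obtained by stacking $M_1(H_W,L_B),\dots,M_n(H_W,L_B)$ vertically in this order. A reduced matrix of $M(H_W,L_B)$ is any $D\in\mathcal{M}_n(\mathbb{Q})$ for which there is $U\in\mathrm{GL}_{n^2}(\mathbb{Z})$ with $U M(H_W,L_B)=\begin{pmatrix}D\\ O\end{pmatrix}$, $O$ being the zero $(n^2-n)\times n$ matrix. Reduced matrices exist and are invertible over $\mathbb{Q}$. *)

theory Defs
  imports
    Complex_Main
    "HOL-Library.Poly_Mapping"
    "Jordan_Normal_Form.Matrix"
    "Jordan_Normal_Form.Gauss_Jordan_Elimination"
begin

section \<open>Rational vector spaces and algebras\<close>

class rat_vector = ab_group_add +
  fixes scaleQ :: "rat \<Rightarrow> 'a \<Rightarrow> 'a" (infixr \<open>*\<^sub>Q\<close> 75)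
  assumes scaleQ_add_right: "q *\<^sub>Q (x + y) = q *\<^sub>Q x + q *\<^sub>Q y"
    and scaleQ_add_left: "(p + q) *\<^sub>Q x = p *\<^sub>Q x + q *\<^sub>Q x"
    and scaleQ_scaleQ: "p *\<^sub>Q (q *\<^sub>Q x) = (p * q) *\<^sub>Q x"
    and scaleQ_one: "1 *\<^sub>Q x = x"

global_interpretation rat_vs: vector_space "scaleQ :: rat \<Rightarrow> 'a \<Rightarrow> 'a::rat_vector"
  by unfold_locales (auto simp: scaleQ_add_right scaleQ_add_left scaleQ_scaleQ scaleQ_one)

text \<open>A not necessarily commutative, associative unital \<open>\<rat>\<close>-algebra.\<close>

class rat_algebra_1 = rat_vector + ring_1 +
  assumes scaleQ_mult_left: "(q *\<^sub>Q x) * y = q *\<^sub>Q (x * y)"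
    and scaleQ_mult_right: "x * (q *\<^sub>Q y) = q *\<^sub>Q (x * y)"

instantiation rat :: rat_algebra_1
begin
definition scaleQ_rat :: "rat \<Rightarrow> rat \<Rightarrow> rat" where "scaleQ_rat = (*)"
instance by standard (auto simp: scaleQ_rat_def algebra_simps)
end

instantiation poly_mapping :: (type, rat_vector) rat_vector
begin
lift_definition scaleQ_poly_mapping :: "rat \<Rightarrow> ('a \<Rightarrow>\<^sub>0 'b) \<Rightarrow> ('a \<Rightarrow>\<^sub>0 'b)"
  is "\<lambda>q f k. q *\<^sub>Q f k"
  by (erule rev_finite_subset) auto
instance
  by standard
    (transfer; simp add: fun_eq_iff scaleQ_add_right scaleQ_add_left scaleQ_scaleQ scaleQ_one)+
end

abbreviation linearQ :: "('a::rat_vector \<Rightarrow> 'b::rat_vector) \<Rightarrow> bool" where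
  "linearQ \<equiv> Vector_Spaces.linear scaleQ scaleQ"

definition bilinearQ :: "('a::rat_vector \<Rightarrow> 'b::rat_vector \<Rightarrow> 'c::rat_vector) \<Rightarrow> bool" where
  "bilinearQ f \<longleftrightarrow> (\<forall>b. linearQ (\<lambda>a. f a b)) \<and> (\<forall>a. linearQ (\<lambda>b. f a b))"

definition finite_dimensionalQ :: "'a::rat_vector itself \<Rightarrow> bool" where
  "finite_dimensionalQ _ \<longleftrightarrow> (\<exists>A :: 'a set. finite A \<and> rat_vs.span A = UNIV)"

lemma linearQI:
  assumes "\<And>x y. f (x + y) = f x + f y" "\<And>q x. f (q *\<^sub>Q x) = q *\<^sub>Q f x"
  shows "linearQ f"
  by (simp add: assms Vector_Spaces.linear_iff rat_vs.vector_space_axioms)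

lemma linearQ_add: "linearQ f \<Longrightarrow> f (x + y) = f x + f y"
  and linearQ_scale: "linearQ f \<Longrightarrow> f (q *\<^sub>Q x) = q *\<^sub>Q f x"
  by (simp_all add: Vector_Spaces.linear_iff)

lemma linearQ_diff: "linearQ f \<Longrightarrow> f (x - y) = f x - f y"
  using linearQ_add[of f "x - y" y] by simp

section \<open>The tensor product over \<open>\<rat>\<close>\<close>

text \<open>The free \<open>\<rat>\<close>-vector space on \<open>'a \<times> 'b\<close> modulo the subspace generated by the
  bilinearity relators.\<close>

definition tensor_gen :: "'a \<Rightarrow> 'b \<Rightarrow> ('a \<times> 'b) \<Rightarrow>\<^sub>0 rat" where
  "tensor_gen a b = Poly_Mapping.single (a, b) 1"

definition tensor_null :: "(('a::rat_vector \<times> 'b::rat_vector) \<Rightarrow>\<^sub>0 rat) set" where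
  "tensor_null = rat_vs.span
     ({tensor_gen (a + a') b - tensor_gen a b - tensor_gen a' b | a a' b. True}
    \<union> {tensor_gen a (b + b') - tensor_gen a b - tensor_gen a b' | a b b'. True}
    \<union> {tensor_gen (q *\<^sub>Q a) b - q *\<^sub>Q tensor_gen a b | q a b. True}
    \<union> {tensor_gen a (q *\<^sub>Q b) - q *\<^sub>Q tensor_gen a b | q a b. True})"

lemma subspace_tensor_null: "rat_vs.subspace tensor_null"
  unfolding tensor_null_def by (rule rat_vs.subspace_span)

lemma tensor_null_0: "0 \<in> tensor_null"
  and tensor_null_add: "x \<in> tensor_null \<Longrightarrow> y \<in> tensor_null \<Longrightarrow> x + y \<in> tensor_null"
  and tensor_null_diff: "x \<in> tensor_null \<Longrightarrow> y \<in> tensor_null \<Longrightarrow> x - y \<in> tensor_null"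
  and tensor_null_scale: "x \<in> tensor_null \<Longrightarrow> q *\<^sub>Q x \<in> tensor_null"
  using rat_vs.subspace_0[OF subspace_tensor_null] rat_vs.subspace_add[OF subspace_tensor_null]
    rat_vs.subspace_diff[OF subspace_tensor_null] rat_vs.subspace_scale[OF subspace_tensor_null]
  by blast+

lemma tensor_null_uminus: "x \<in> tensor_null \<Longrightarrow> - x \<in> tensor_null"
  using tensor_null_diff[OF tensor_null_0] by simp

quotient_type (overloaded) ('a, 'b) tensor =
  "(('a::rat_vector \<times> 'b::rat_vector) \<Rightarrow>\<^sub>0 rat)" / "\<lambda>x y. x - y \<in> tensor_null"
proof (rule equivpI)
  show "reflp (\<lambda>x y. x - y \<in> tensor_null)"
    by (simp add: reflp_def tensor_null_0)
  show "symp (\<lambda>x y. x - y \<in> tensor_null)"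
  proof (rule sympI)
    fix x y assume "x - y \<in> tensor_null"
    from tensor_null_uminus[OF this] show "y - x \<in> tensor_null" by simp
  qed
  show "transp (\<lambda>x y. x - y \<in> tensor_null)"
  proof (rule transpI)
    fix x y z assume "x - y \<in> tensor_null" "y - z \<in> tensor_null"
    from tensor_null_add[OF this] show "x - z \<in> tensor_null" by simp
  qed
qed

instantiation tensor :: (rat_vector, rat_vector) rat_vector
begin

lift_definition zero_tensor :: "('a, 'b) tensor" is 0 .

lift_definition plus_tensor :: "('a, 'b) tensor \<Rightarrow> ('a, 'b) tensor \<Rightarrow> ('a, 'b) tensor" is "(+)"
  by (simp only: add_diff_add) (rule tensor_null_add)

lift_definition uminus_tensor :: "('a, 'b) tensor \<Rightarrow> ('a, 'b) tensor" is "uminus"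
  by (simp only: minus_diff_minus) (rule tensor_null_uminus)

lift_definition minus_tensor :: "('a, 'b) tensor \<Rightarrow> ('a, 'b) tensor \<Rightarrow> ('a, 'b) tensor" is "(-)"
proof -
  fix x x' y y' :: "('a \<times> 'b) \<Rightarrow>\<^sub>0 rat"
  assume "x - x' \<in> tensor_null" "y - y' \<in> tensor_null"
  then have "(x - x') - (y - y') \<in> tensor_null" by (rule tensor_null_diff)
  then show "x - y - (x' - y') \<in> tensor_null" by (simp add: algebra_simps)
qed

lift_definition scaleQ_tensor :: "rat \<Rightarrow> ('a, 'b) tensor \<Rightarrow> ('a, 'b) tensor" is "scaleQ"
  by (simp only: rat_vs.scale_right_diff_distrib[symmetric]) (rule tensor_null_scale)

instance
  by standard
    (transfer;
      simp add: tensor_null_0 algebra_simps scaleQ_add_right scaleQ_add_left scaleQ_scaleQ scaleQ_one)+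

end

lift_definition tensor_of :: "'a::rat_vector \<Rightarrow> 'b::rat_vector \<Rightarrow> ('a, 'b) tensor" (infixr \<open>\<otimes>\<^sub>Q\<close> 70)
  is tensor_gen .

text \<open>The linear map on the tensor product induced by a bilinear map; for \<open>f\<close> bilinear the
  value does not depend on the chosen representative, see \<open>tensor_lift_of\<close> and
  \<open>linearQ_tensor_lift\<close> below.\<close>

definition free_lift :: "('a \<Rightarrow> 'b \<Rightarrow> 'c::rat_vector) \<Rightarrow> (('a \<times> 'b) \<Rightarrow>\<^sub>0 rat) \<Rightarrow> 'c" where
  "free_lift f x = (\<Sum>(a, b)\<in>Poly_Mapping.keys x. Poly_Mapping.lookup x (a, b) *\<^sub>Q f a b)"

definition tensor_lift ::
  "('a::rat_vector \<Rightarrow> 'b::rat_vector \<Rightarrow> 'c::rat_vector) \<Rightarrow> ('a, 'b) tensor \<Rightarrow> 'c" where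
  "tensor_lift f t = free_lift f (rep_tensor t)"

lemma free_lift_superset:
  assumes "finite S" "Poly_Mapping.keys x \<subseteq> S"
  shows "free_lift f x = (\<Sum>(a, b)\<in>S. Poly_Mapping.lookup x (a, b) *\<^sub>Q f a b)"
  unfolding free_lift_def
  by (rule sum.mono_neutral_left) (use assms in \<open>auto simp: Poly_Mapping.in_keys_iff\<close>)

lemma linearQ_free_lift: "linearQ (free_lift f)"
proof (rule linearQI)
  fix x y :: "('a \<times> 'b) \<Rightarrow>\<^sub>0 rat" and q :: rat
  let ?S = "Poly_Mapping.keys x \<union> Poly_Mapping.keys y"
  have "Poly_Mapping.keys (x + y) \<subseteq> ?S"
    by (rule Poly_Mapping.keys_add)
  then show "free_lift f (x + y) = free_lift f x + free_lift f y"
    by (simp add: free_lift_superset[of ?S] Poly_Mapping.lookup_add scaleQ_add_left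
        case_prod_unfold flip: sum.distrib)
  have l: "Poly_Mapping.lookup (q *\<^sub>Q x) k = q * Poly_Mapping.lookup x k" for k
    by (simp add: scaleQ_poly_mapping.rep_eq scaleQ_rat_def)
  then have "Poly_Mapping.keys (q *\<^sub>Q x) \<subseteq> Poly_Mapping.keys x"
    by (auto simp: Poly_Mapping.in_keys_iff)
  then show "free_lift f (q *\<^sub>Q x) = q *\<^sub>Q free_lift f x"
    by (simp add: free_lift_superset[of "Poly_Mapping.keys x"] l rat_vs.scale_sum_right
        case_prod_unfold)
qed

lemma free_lift_gen: "free_lift f (tensor_gen a b) = f a b"
  by (simp add: free_lift_def tensor_gen_def scaleQ_one)

lemma free_lift_null:
  assumes "bilinearQ f" "x \<in> tensor_null"
  shows "free_lift f x = 0"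
proof -
  note lin = linearQ_diff[OF linearQ_free_lift] linearQ_scale[OF linearQ_free_lift]
    linearQ_add[OF linearQ_free_lift]
  have l: "linearQ (\<lambda>a. f a b)" and r: "linearQ (f a)" for a b
    using assms(1) by (auto simp: bilinearQ_def)
  note bi = linearQ_add[OF l] linearQ_add[OF r] linearQ_scale[OF l] linearQ_scale[OF r]
  have "rat_vs.subspace {x. free_lift f x = 0}"
    by (rule rat_vs.subspaceI) (auto simp: lin free_lift_def[of f 0])
  then have "tensor_null \<subseteq> {x. free_lift f x = 0}"
    unfolding tensor_null_def
    by (intro rat_vs.span_minimal) (auto simp: lin bi free_lift_gen)
  with assms(2) show ?thesis by blast
qed

lemma tensor_lift_abs:
  assumes "bilinearQ f"
  shows "tensor_lift f (abs_tensor x) = free_lift f x"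
proof -
  have "rep_tensor (abs_tensor x) - x \<in> tensor_null"
    using rep_abs_rsp_left[OF Quotient3_tensor, of x x] by (simp add: tensor_null_0)
  from free_lift_null[OF assms this] show ?thesis
    by (simp add: tensor_lift_def linearQ_diff[OF linearQ_free_lift])
qed

lemma tensor_lift_of: "bilinearQ f \<Longrightarrow> tensor_lift f (a \<otimes>\<^sub>Q b) = f a b"
  by (simp add: tensor_of.abs_eq tensor_lift_abs free_lift_gen)

lemma linearQ_tensor_lift:
  assumes "bilinearQ f"
  shows "linearQ (tensor_lift f)"
proof (rule linearQI)
  fix s t :: "('a, 'b) tensor" and q :: rat
  obtain x y where st: "s = abs_tensor x" "t = abs_tensor y"
    using Quotient3_abs_rep[OF Quotient3_tensor] by (metis (no_types))
  show "tensor_lift f (s + t) = tensor_lift f s + tensor_lift f t"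
    unfolding st by (simp add: plus_tensor.abs_eq tensor_lift_abs[OF assms]
        linearQ_add[OF linearQ_free_lift])
  show "tensor_lift f (q *\<^sub>Q s) = q *\<^sub>Q tensor_lift f s"
    unfolding st by (simp add: scaleQ_tensor.abs_eq tensor_lift_abs[OF assms]
        linearQ_scale[OF linearQ_free_lift])
qed

lemma bilinearQ_tensor_of: "bilinearQ (\<otimes>\<^sub>Q)"
  unfolding bilinearQ_def
proof (intro conjI allI linearQI)
  fix a a' :: 'a and b b' :: 'b and q :: rat
  show "(a + a') \<otimes>\<^sub>Q b = a \<otimes>\<^sub>Q b + a' \<otimes>\<^sub>Q b"
    by transfer (simp only: tensor_null_def diff_diff_eq[symmetric], rule rat_vs.span_base, blast)
  show "a \<otimes>\<^sub>Q (b + b') = a \<otimes>\<^sub>Q b + a \<otimes>\<^sub>Q b'"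
    by transfer (simp only: tensor_null_def diff_diff_eq[symmetric], rule rat_vs.span_base, blast)
  show "(q *\<^sub>Q a) \<otimes>\<^sub>Q b = q *\<^sub>Q (a \<otimes>\<^sub>Q b)"
    by transfer (simp only: tensor_null_def, rule rat_vs.span_base, blast)
  show "a \<otimes>\<^sub>Q (q *\<^sub>Q b) = q *\<^sub>Q (a \<otimes>\<^sub>Q b)"
    by transfer (simp only: tensor_null_def, rule rat_vs.span_base, blast)
qed

definition tensor_map ::
  "('a::rat_vector \<Rightarrow> 'c::rat_vector) \<Rightarrow> ('b::rat_vector \<Rightarrow> 'd::rat_vector)
   \<Rightarrow> ('a, 'b) tensor \<Rightarrow> ('c, 'd) tensor" where
  "tensor_map f g = tensor_lift (\<lambda>a b. f a \<otimes>\<^sub>Q g b)"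

definition tensor_swap :: "('a::rat_vector, 'b::rat_vector) tensor \<Rightarrow> ('b, 'a) tensor" where
  "tensor_swap = tensor_lift (\<lambda>a b. b \<otimes>\<^sub>Q a)"

definition tensor_assoc ::
  "(('a::rat_vector, 'b::rat_vector) tensor, 'c::rat_vector) tensor \<Rightarrow> ('a, ('b, 'c) tensor) tensor" where
  "tensor_assoc = tensor_lift (\<lambda>t c. tensor_lift (\<lambda>a b. a \<otimes>\<^sub>Q (b \<otimes>\<^sub>Q c)) t)"

text \<open>The product \<open>(a \<otimes> b)(c \<otimes> d) = ac \<otimes> bd\<close>.\<close>

definition tensor_mult ::
  "('a::rat_algebra_1, 'b::rat_algebra_1) tensor \<Rightarrow> ('a, 'b) tensor \<Rightarrow> ('a, 'b) tensor" where
  "tensor_mult s t =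
     tensor_lift (\<lambda>a b. tensor_lift (\<lambda>c d. (a * c) \<otimes>\<^sub>Q (b * d)) t) s"

section \<open>Hopf algebras and Hopf-Galois structures\<close>

locale rat_hopf_algebra =
  fixes comult :: "'h::rat_algebra_1 \<Rightarrow> ('h, 'h) tensor"
    and counit :: "'h \<Rightarrow> rat"
    and antipode :: "'h \<Rightarrow> 'h"
  assumes comult_linear: "linearQ comult"
    and counit_linear: "linearQ counit"
    and antipode_linear: "linearQ antipode"
    and coassoc: "tensor_assoc (tensor_map comult id (comult h)) = tensor_map id comult (comult h)"
    and counit_left: "tensor_lift (\<lambda>a b. counit a *\<^sub>Q b) (comult h) = h"
    and counit_right: "tensor_lift (\<lambda>a b. counit b *\<^sub>Q a) (comult h) = h"
    and comult_one: "comult 1 = 1 \<otimes>\<^sub>Q 1"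
    and comult_mult: "comult (g * h) = tensor_mult (comult g) (comult h)"
    and counit_one: "counit 1 = 1"
    and counit_mult: "counit (g * h) = counit g * counit h"
    and antipode_left: "tensor_lift (\<lambda>a b. antipode a * b) (comult h) = counit h *\<^sub>Q 1"
    and antipode_right: "tensor_lift (\<lambda>a b. a * antipode b) (comult h) = counit h *\<^sub>Q 1"

locale cocommutative_rat_hopf_algebra = rat_hopf_algebra +
  assumes cocommutative: "tensor_swap (comult h) = comult h"

locale module_algebra = rat_hopf_algebra comult counit antipode
  for comult :: "'h::rat_algebra_1 \<Rightarrow> ('h, 'h) tensor" and counit antipode +
  fixes act :: "('h, 'l::rat_algebra_1) tensor \<Rightarrow> 'l"
  assumes act_linear: "linearQ act"
    and act_one_left: "act (1 \<otimes>\<^sub>Q x) = x"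
    and act_mult_left: "act ((g * h) \<otimes>\<^sub>Q x) = act (g \<otimes>\<^sub>Q act (h \<otimes>\<^sub>Q x))"
    and act_one_right: "act (h \<otimes>\<^sub>Q 1) = counit h *\<^sub>Q 1"
    and act_mult_right:
      "act (h \<otimes>\<^sub>Q (x * y)) = tensor_lift (\<lambda>h1 h2. act (h1 \<otimes>\<^sub>Q x) * act (h2 \<otimes>\<^sub>Q y)) (comult h)"

text \<open>The map \<open>L \<otimes> H \<rightarrow> End(L)\<close>, \<open>x \<otimes> h \<mapsto> (y \<mapsto> x(h \<cdot> y))\<close>, with the lift taken at each
  argument \<open>y\<close>. Since it is linear in the tensor at each \<open>y\<close>, it is a linear isomorphism iff it
  is a bijection onto the set of linear endomorphisms.\<close>

definition galois_map ::
  "(('h::rat_algebra_1, 'l::rat_algebra_1) tensor \<Rightarrow> 'l) \<Rightarrow> ('l, 'h) tensor \<Rightarrow> 'l \<Rightarrow> 'l" where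
  "galois_map act t = (\<lambda>y. tensor_lift (\<lambda>x h. x * act (h \<otimes>\<^sub>Q y)) t)"

locale hopf_galois_structure =
  cocommutative_rat_hopf_algebra comult counit antipode +
  module_algebra comult counit antipode act
  for comult :: "'h::rat_algebra_1 \<Rightarrow> ('h, 'h) tensor" and counit antipode
    and act :: "('h, 'l::{field, rat_algebra_1}) tensor \<Rightarrow> 'l" +
  assumes finite_dimensional_hopf: "finite_dimensionalQ TYPE('h)"
    and galois: "bij_betw (galois_map act) UNIV {f. linearQ f}"

section \<open>Bases and orders\<close>

global_interpretation int_mod: Modules.module "\<lambda>(k::int) (x::'a::ring_1). of_int k * x"
  by unfold_locales (auto simp: algebra_simps)

text \<open>Bases are families indexed by \<open>0, \<dots>, n - 1\<close>.\<close>

definition rat_basis :: "nat \<Rightarrow> (nat \<Rightarrow> 'a::rat_vector) \<Rightarrow> bool" where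
  "rat_basis n w \<longleftrightarrow> inj_on w {..<n} \<and> rat_vs.independent (w ` {..<n})
     \<and> rat_vs.span (w ` {..<n}) = UNIV"

definition int_basis :: "nat \<Rightarrow> (nat \<Rightarrow> 'a::ring_1) \<Rightarrow> 'a set \<Rightarrow> bool" where
  "int_basis n v A \<longleftrightarrow> inj_on v {..<n} \<and> int_mod.independent (v ` {..<n})
     \<and> int_mod.span (v ` {..<n}) = A"

definition int_order :: "'l::rat_algebra_1 set \<Rightarrow> bool" where
  "int_order \<O> \<longleftrightarrow>
     1 \<in> \<O> \<and> (\<forall>x\<in>\<O>. \<forall>y\<in>\<O>. x - y \<in> \<O>) \<and> (\<forall>x\<in>\<O>. \<forall>y\<in>\<O>. x * y \<in> \<O>)
     \<and> (\<exists>G. finite G \<and> \<O> = int_mod.span G)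
     \<and> (\<exists>C\<subseteq>\<O>. rat_vs.independent C \<and> rat_vs.span C = UNIV)"

definition associated_order ::
  "(('h::rat_algebra_1, 'l::rat_algebra_1) tensor \<Rightarrow> 'l) \<Rightarrow> 'l set \<Rightarrow> 'h set" where
  "associated_order act \<O> = {h. \<forall>x\<in>\<O>. act (h \<otimes>\<^sub>Q x) \<in> \<O>}"

section \<open>The matrix of the action and its reduced matrices\<close>

text \<open>Column \<open>i\<close> holds the coordinates of \<open>w i \<cdot> \<gamma> j\<close> with respect to \<open>\<gamma>\<close>.\<close>

definition action_block ::
  "(('h::rat_algebra_1, 'l::rat_algebra_1) tensor \<Rightarrow> 'l) \<Rightarrow> nat \<Rightarrow> (nat \<Rightarrow> 'h) \<Rightarrow> (nat \<Rightarrow> 'l)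
   \<Rightarrow> nat \<Rightarrow> rat mat" where
  "action_block act n w \<gamma> j =
     mat n n (\<lambda>(k, i). rat_vs.representation (\<gamma> ` {..<n}) (act (w i \<otimes>\<^sub>Q \<gamma> j)) (\<gamma> k))"

text \<open>The blocks for \<open>j = 0, \<dots>, n - 1\<close> stacked vertically.\<close>

definition action_matrix ::
  "(('h::rat_algebra_1, 'l::rat_algebra_1) tensor \<Rightarrow> 'l) \<Rightarrow> nat \<Rightarrow> (nat \<Rightarrow> 'h) \<Rightarrow> (nat \<Rightarrow> 'l)
   \<Rightarrow> rat mat" where
  "action_matrix act n w \<gamma> =
     mat (n\<^sup>2) n (\<lambda>(r, i). action_block act n w \<gamma> (r div n) $$ (r mod n, i))"

definition reduced_matrix :: "nat \<Rightarrow> rat mat \<Rightarrow> rat mat \<Rightarrow> bool" where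
  "reduced_matrix n M D \<longleftrightarrow> D \<in> carrier_mat n n \<and>
     (\<exists>U :: int mat. U \<in> carrier_mat (n\<^sup>2) (n\<^sup>2) \<and> invertible_mat U
        \<and> map_mat rat_of_int U * M = D @\<^sub>r 0\<^sub>m (n\<^sup>2 - n) n)"

end

(* For h = sum of c_l w_l, the entries of M c are the coordinates of the h.gamma_j in the
   Z-basis gamma of O, so h lies in the associated order iff M c is integral. Multiplying by the
   unimodular U does not change integrality, so this happens iff D c is integral, that is, iff
   c = D^-1 z with z in Z^n; these h are the integral combinations of the v_i. D is invertible
   since D c = 0 forces h to act as zero, and the action is faithful by injectivity of the Galois
   map. *)
theory Submission
  imports Defs "Jordan_Normal_Form.Determinant"
begin

section \<open>Independence and span of indexed families, over the rationals and the integers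
  alike\<close>

lemma (in Modules.module) independent_family_iff:
  assumes "finite I"
  shows "inj_on v I \<and> independent (v ` I) \<longleftrightarrow>
    (\<forall>c. (\<Sum>i\<in>I. c i *s v i) = 0 \<longrightarrow> (\<forall>i\<in>I. c i = 0))"
proof (intro iffI conjI)
  assume *: "inj_on v I \<and> independent (v ` I)"
  show "\<forall>c. (\<Sum>i\<in>I. c i *s v i) = 0 \<longrightarrow> (\<forall>i\<in>I. c i = 0)"
  proof (intro allI impI ballI)
    fix c i assume c: "(\<Sum>i\<in>I. c i *s v i) = 0" and i: "i \<in> I"
    let ?u = "\<lambda>x. c (the_inv_into I v x)"
    have "(\<Sum>x\<in>v ` I. ?u x *s x) = (\<Sum>i\<in>I. c i *s v i)"
      using * by (subst sum.reindex) (auto simp: the_inv_into_f_f)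
    with c have "?u (v i) = 0"
      using * i assms by (intro independentD[of "v ` I" "v ` I" ?u]) auto
    with * i show "c i = 0" by (simp add: the_inv_into_f_f)
  qed
next
  assume *: "\<forall>c. (\<Sum>i\<in>I. c i *s v i) = 0 \<longrightarrow> (\<forall>i\<in>I. c i = 0)"
  show inj: "inj_on v I"
  proof (rule inj_onI, rule ccontr)
    fix i j assume ij: "i \<in> I" "j \<in> I" "v i = v j" "i \<noteq> j"
    \<comment> \<open>A repeated vector yields the relation \<open>v i - v j = 0\<close>, whose
      coefficient at \<open>i\<close> is 1.\<close>
    define c :: "_ \<Rightarrow> 'a" where "c k = (if k = i then 1 else 0) - (if k = j then 1 else 0)" for k
    have "(\<Sum>k\<in>I. c k *s v k) = 0"
      unfolding c_def using ij assms
      by (simp add: scale_left_diff_distrib sum_subtractf if_distrib[of "\<lambda>a. a *s _"] cong: if_cong)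
    with * ij(1) have "c i = 0" by blast
    with ij(4) show False by (simp add: c_def)
  qed
  show "independent (v ` I)"
    using assms * inj
    by (auto simp: dependent_finite sum.reindex)
qed

lemma (in Modules.module) span_family:
  assumes "finite I"
  shows "span (v ` I) = range (\<lambda>c. \<Sum>i\<in>I. c i *s v i)"
proof -
  have "range (\<lambda>c. \<Sum>i\<in>I. c i *s v i) \<subseteq> span (v ` I)"
    by (auto intro: span_sum span_scale span_base)
  moreover have "subspace (range (\<lambda>c. \<Sum>i\<in>I. c i *s v i))"
  proof (rule subspaceI)
    show "0 \<in> range (\<lambda>c. \<Sum>i\<in>I. c i *s v i)"
      by (rule range_eqI[of _ _ "\<lambda>_. 0"]) simp
  next
    fix x y assume "x \<in> range (\<lambda>c. \<Sum>i\<in>I. c i *s v i)" "y \<in> range (\<lambda>c. \<Sum>i\<in>I. c i *s v i)"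
    then obtain c d where "x = (\<Sum>i\<in>I. c i *s v i)" "y = (\<Sum>i\<in>I. d i *s v i)" by blast
    then show "x + y \<in> range (\<lambda>c. \<Sum>i\<in>I. c i *s v i)"
      by (intro range_eqI[of _ _ "\<lambda>i. c i + d i"]) (simp add: scale_left_distrib sum.distrib)
  next
    fix a x assume "x \<in> range (\<lambda>c. \<Sum>i\<in>I. c i *s v i)"
    then obtain c where "x = (\<Sum>i\<in>I. c i *s v i)" by blast
    then show "a *s x \<in> range (\<lambda>c. \<Sum>i\<in>I. c i *s v i)"
      by (intro range_eqI[of _ _ "\<lambda>i. a * c i"]) (simp add: scale_sum_right)
  qed
  moreover have "v ` I \<subseteq> range (\<lambda>c. \<Sum>i\<in>I. c i *s v i)"
  proof
    fix x assume "x \<in> v ` I"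
    then obtain j where "j \<in> I" "x = v j" by blast
    then show "x \<in> range (\<lambda>c. \<Sum>i\<in>I. c i *s v i)"
      using assms by (intro range_eqI[of _ _ "\<lambda>i. if i = j then 1 else 0"])
        (simp add: if_distrib[of "\<lambda>a. a *s _"] cong: if_cong)
  qed
  ultimately show ?thesis
    by (intro subset_antisym span_minimal)
qed

text \<open>\<open>int_mod\<close> scales by ring multiplication and \<open>rat_vs\<close> by
  \<open>scaleQ\<close>. Identifying the two on integers lets integral and rational combinations be
  compared in one notation.\<close>

lemma of_int_mult_eq_scaleQ: "of_int k * (x :: 'a::rat_algebra_1) = of_int k *\<^sub>Q x"
proof (induction k)
  case (nonneg n)
  then show ?case
    by (induction n) (simp_all add: algebra_simps scaleQ_add_left scaleQ_one)
next
  case (neg n)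
  then show ?case
  proof (induction n)
    case 0
    then show ?case by (simp add: scaleQ_one)
  next
    case (Suc n)
    have e: "- int (Suc (Suc n)) = - int (Suc n) - 1" by simp
    show ?case
      unfolding e of_int_diff using Suc
      by (simp only: left_diff_distrib rat_vs.scale_left_diff_distrib) (simp add: scaleQ_one)
  qed
qed

lemma rat_basis_iff:
  "rat_basis n w \<longleftrightarrow>
     (\<forall>c. (\<Sum>i<n. c i *\<^sub>Q w i) = 0 \<longrightarrow> (\<forall>i<n. c i = 0)) \<and> range (\<lambda>c. \<Sum>i<n. c i *\<^sub>Q w i) = UNIV"
  unfolding rat_basis_def
  using rat_vs.independent_family_iff[of "{..<n}" w] rat_vs.span_family[of "{..<n}" w]
  by (simp add: Ball_def conj_assoc[symmetric])

lemma int_basis_iff: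
  fixes v :: "nat \<Rightarrow> 'a::rat_algebra_1"
  shows "int_basis n v A \<longleftrightarrow>
     (\<forall>z. (\<Sum>i<n. of_int (z i) *\<^sub>Q v i) = 0 \<longrightarrow> (\<forall>i<n. z i = 0)) \<and>
     range (\<lambda>z. \<Sum>i<n. of_int (z i) *\<^sub>Q v i) = A"
proof -
  have "inj_on v {..<n} \<and> int_mod.independent (v ` {..<n}) \<longleftrightarrow>
      (\<forall>z. (\<Sum>i<n. of_int (z i) *\<^sub>Q v i) = 0 \<longrightarrow> (\<forall>i<n. z i = 0))"
    unfolding int_mod.independent_family_iff[OF finite_lessThan]
    unfolding of_int_mult_eq_scaleQ by (simp add: Ball_def)
  moreover have "int_mod.span (v ` {..<n}) = range (\<lambda>z. \<Sum>i<n. of_int (z i) *\<^sub>Q v i)"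
    unfolding int_mod.span_family[OF finite_lessThan]
    unfolding of_int_mult_eq_scaleQ by simp
  ultimately show ?thesis
    unfolding int_basis_def conj_assoc[symmetric] by simp
qed

section \<open>Denominators, integral coordinates and bases of orders\<close>

lemma Ints_family:
  assumes "\<forall>i<n. f i \<in> \<int>"
  obtains z :: "nat \<Rightarrow> int" where "\<forall>i<n. f i = of_int (z i)"
proof -
  have "\<forall>i. \<exists>z::int. i < n \<longrightarrow> f i = of_int z"
    using assms by (auto elim!: Ints_cases)
  then obtain z :: "nat \<Rightarrow> int" where "\<forall>i<n. f i = of_int (z i)"
    unfolding choice_iff ..
  then show thesis using that by blast
qed

lemma common_denominator:
  fixes q :: "'i \<Rightarrow> rat"
  assumes "finite I"
  obtains d :: int where "d > 0" "\<And>i. i \<in> I \<Longrightarrow> of_int d * q i \<in> \<int>"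
proof -
  have "\<exists>d::int > 0. \<forall>i\<in>I. of_int d * q i \<in> \<int>"
    using assms
  proof (induction I rule: finite_induct)
    case (insert j I)
    then obtain d :: int where d: "d > 0" "\<forall>i\<in>I. of_int d * q i \<in> \<int>" by blast
    obtain a b where ab: "q j = Rat.Fract a b" "b > 0"
      by (cases "q j") auto
    have "of_int (d * b) * q i = of_int b * (of_int d * q i)" for i by simp
    moreover have "of_int (d * b) * q j = of_int (d * a)"
      using ab by (simp add: Fract_of_int_quotient)
    ultimately have "\<forall>i\<in>insert j I. of_int (d * b) * q i \<in> \<int>"
      using d(2) by (metis Ints_mult Ints_of_int insert_iff)
    with d(1) ab(2) show ?case by (intro exI[of _ "d * b"]) simp
  qed (auto intro: exI[of _ 1])
  then show ?thesis using that by blast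
qed

text \<open>Clearing denominators turns a rational relation into an integral one, hence a trivial
  one. For spanning, the order contains a rational spanning set and lies in the rational span of its
  integral basis.\<close>

lemma rat_basis_if_int_basis_order:
  fixes \<gamma> :: "nat \<Rightarrow> 'l::rat_algebra_1"
  assumes "int_order \<O>" "int_basis n \<gamma> \<O>"
  shows "rat_basis n \<gamma>"
  unfolding rat_basis_iff
proof (intro conjI allI impI)
  fix c i assume c: "(\<Sum>i<n. c i *\<^sub>Q \<gamma> i) = 0" and i: "i < n"
  obtain d :: int where d: "d > 0" "\<And>i. i \<in> {..<n} \<Longrightarrow> of_int d * c i \<in> \<int>"
    by (rule common_denominator[of "{..<n}" c]) auto
  obtain z where z: "\<forall>i<n. of_int d * c i = of_int (z i)"
    by (rule Ints_family[of n "\<lambda>i. of_int d * c i"]) (use d(2) in auto)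
  have "(\<Sum>i<n. of_int (z i) *\<^sub>Q \<gamma> i) = of_int d *\<^sub>Q (\<Sum>i<n. c i *\<^sub>Q \<gamma> i)"
    unfolding rat_vs.scale_sum_right by (rule sum.cong) (auto simp: scaleQ_scaleQ z)
  with c have "z i = 0"
    using assms(2) i unfolding int_basis_iff by simp
  moreover have "of_int d * c i = of_int (z i)" using z i by blast
  ultimately show "c i = 0" using d(1) by simp
next
  obtain C where C: "C \<subseteq> \<O>" "rat_vs.span C = UNIV"
    using assms(1) unfolding int_order_def by blast
  have "\<O> \<subseteq> rat_vs.span (\<gamma> ` {..<n})"
  proof
    fix x assume "x \<in> \<O>"
    then obtain z where "x = (\<Sum>i<n. of_int (z i) *\<^sub>Q \<gamma> i)"
      using assms(2) unfolding int_basis_iff by blast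
    then show "x \<in> rat_vs.span (\<gamma> ` {..<n})"
      by (auto intro: rat_vs.span_sum rat_vs.span_scale rat_vs.span_base)
  qed
  with C have "rat_vs.span (\<gamma> ` {..<n}) = UNIV"
    by (metis rat_vs.span_minimal rat_vs.subspace_span subset_trans top.extremum_uniqueI)
  then show "range (\<lambda>c. \<Sum>i<n. c i *\<^sub>Q \<gamma> i) = UNIV"
    by (simp add: rat_vs.span_family)
qed

lemma rat_basis_coordinates:
  assumes "rat_basis n w"
  obtains c where "x = (\<Sum>i<n. c i *\<^sub>Q w i)"
proof -
  have "x \<in> range (\<lambda>c. \<Sum>i<n. c i *\<^sub>Q w i)"
    using assms unfolding rat_basis_iff by simp
  then show thesis using that by blast
qed

lemma representation_rat_basis:
  assumes "rat_basis n \<gamma>" "k < n"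
  shows "rat_vs.representation (\<gamma> ` {..<n}) (\<Sum>i<n. c i *\<^sub>Q \<gamma> i) (\<gamma> k) = c k"
proof -
  have ind: "rat_vs.independent (\<gamma> ` {..<n})" and inj: "inj_on \<gamma> {..<n}"
    using assms(1) by (auto simp: rat_basis_def)
  have "rat_vs.representation (\<gamma> ` {..<n}) (\<Sum>i<n. c i *\<^sub>Q \<gamma> i) (\<gamma> k) =
    (\<Sum>i<n. c i * (if \<gamma> k = \<gamma> i then 1 else 0))"
    by (subst rat_vs.representation_sum[OF ind])
      (auto intro: rat_vs.span_scale rat_vs.span_base
        simp: rat_vs.representation_scale[OF ind rat_vs.span_base] rat_vs.representation_basis[OF ind])
  \<comment> \<open>\<open>representation\<close> indexes coordinates by basis vectors; injectivity
    of the family recovers the index from the vector.\<close>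
  also have "\<dots> = (\<Sum>i<n. if i = k then c i else 0)"
    using inj assms(2) by (intro sum.cong) (auto simp: inj_on_def)
  finally show ?thesis using assms(2) by simp
qed

lemma sum_representation_rat_basis:
  assumes "rat_basis n \<gamma>"
  shows "(\<Sum>k<n. rat_vs.representation (\<gamma> ` {..<n}) x (\<gamma> k) *\<^sub>Q \<gamma> k) = x"
proof -
  obtain c where "x = (\<Sum>i<n. c i *\<^sub>Q \<gamma> i)"
    by (rule rat_basis_coordinates[OF assms])
  then show ?thesis by (simp add: representation_rat_basis[OF assms])
qed

text \<open>Rational coordinates are unique, so the integer coefficients of an element of the order
  are its rational coordinates. This makes membership a question of integrality.\<close>

lemma mem_int_basis_iff:
  fixes \<gamma> :: "nat \<Rightarrow> 'l::rat_algebra_1"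
  assumes "rat_basis n \<gamma>" "int_basis n \<gamma> \<O>"
  shows "x \<in> \<O> \<longleftrightarrow> (\<forall>k<n. rat_vs.representation (\<gamma> ` {..<n}) x (\<gamma> k) \<in> \<int>)"
proof
  assume "x \<in> \<O>"
  then obtain z where "x = (\<Sum>i<n. of_int (z i) *\<^sub>Q \<gamma> i)"
    using assms(2) unfolding int_basis_iff by blast
  then show "\<forall>k<n. rat_vs.representation (\<gamma> ` {..<n}) x (\<gamma> k) \<in> \<int>"
    by (simp add: representation_rat_basis[OF assms(1)])
next
  assume "\<forall>k<n. rat_vs.representation (\<gamma> ` {..<n}) x (\<gamma> k) \<in> \<int>"
  then obtain z where "\<forall>k<n. rat_vs.representation (\<gamma> ` {..<n}) x (\<gamma> k) = of_int (z k)"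
    by (rule Ints_family[of n "\<lambda>k. rat_vs.representation (\<gamma> ` {..<n}) x (\<gamma> k)"])
  then have "x = (\<Sum>k<n. of_int (z k) *\<^sub>Q \<gamma> k)"
    using sum_representation_rat_basis[OF assms(1), of x] by simp
  then show "x \<in> \<O>"
    using assms(2) unfolding int_basis_iff by blast
qed

section \<open>Linearity, tensors and faithfulness of the action\<close>

lemma linearQ_zero: "linearQ f \<Longrightarrow> f 0 = 0"
  using linearQ_scale[of f 0 0] by simp

lemma linearQ_sum: "linearQ f \<Longrightarrow> f (\<Sum>i\<in>I. c i *\<^sub>Q x i) = (\<Sum>i\<in>I. c i *\<^sub>Q f (x i))"
  by (induction I rule: infinite_finite_induct)
    (simp_all add: linearQ_zero linearQ_add linearQ_scale)

lemma linearQ_tensor_left: "linearQ (\<lambda>a. a \<otimes>\<^sub>Q b)"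
  and linearQ_tensor_right: "linearQ (\<lambda>b. a \<otimes>\<^sub>Q b)"
  using bilinearQ_tensor_of by (auto simp: bilinearQ_def)

text \<open>A linear functional on \<open>L\<close> taking the value \<open>1\<close> at \<open>1\<close> induces a retraction \<open>L \<otimes> H \<rightarrow> H\<close>
  of \<open>h \<mapsto> 1 \<otimes> h\<close>.\<close>

lemma one_tensor_eq_0_iff:
  fixes h :: "'h::rat_vector"
  shows "(1 :: 'l::{field, rat_algebra_1}) \<otimes>\<^sub>Q h = 0 \<longleftrightarrow> h = 0"
proof
  assume h: "(1 :: 'l) \<otimes>\<^sub>Q h = 0"
  \<comment> \<open>The functional is the coordinate at 1 in a basis of \<open>'l\<close> extending
    \<open>{1}\<close>, which is independent because 1 is nonzero in a field.\<close>
  let ?B = "rat_vs.extend_basis {1 :: 'l}"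
  let ?\<phi> = "\<lambda>x. rat_vs.representation ?B x 1"
  have 1: "rat_vs.independent {1 :: 'l}" by simp
  note B = rat_vs.independent_extend_basis[OF 1]
  have "1 \<in> ?B" using rat_vs.extend_basis_superset[OF 1] by simp
  then have \<phi>1: "?\<phi> 1 = 1" by (simp add: rat_vs.representation_basis[OF B])
  have bil: "bilinearQ (\<lambda>x (h::'h). ?\<phi> x *\<^sub>Q h)"
    unfolding bilinearQ_def
    by (intro conjI allI linearQI)
      (simp_all add: rat_vs.representation_add[OF B] rat_vs.representation_scale[OF B] 1
        scaleQ_add_left scaleQ_add_right scaleQ_scaleQ mult.commute)
  have "h = tensor_lift (\<lambda>x (h::'h). ?\<phi> x *\<^sub>Q h) (1 \<otimes>\<^sub>Q h)"
    by (simp add: tensor_lift_of[OF bil] \<phi>1 scaleQ_one)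
  also have "\<dots> = 0"
    unfolding h by (rule linearQ_zero[OF linearQ_tensor_lift[OF bil]])
  finally show "h = 0" .
qed (simp add: linearQ_zero[OF linearQ_tensor_right])

lemma (in module_algebra) linearQ_act_left: "linearQ (\<lambda>h. act (h \<otimes>\<^sub>Q x))"
  and linearQ_act_right: "linearQ (\<lambda>x. act (h \<otimes>\<^sub>Q x))"
  by (rule linearQI; simp add: linearQ_add[OF act_linear] linearQ_scale[OF act_linear]
      linearQ_add[OF linearQ_tensor_left] linearQ_scale[OF linearQ_tensor_left]
      linearQ_add[OF linearQ_tensor_right] linearQ_scale[OF linearQ_tensor_right])+

text \<open>If \<open>h\<close> acts as zero, then 1 tensor \<open>h\<close> and 0 have the same
  image under the Galois map. Injectivity makes this tensor vanish, and tensoring with 1 loses no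
  information about \<open>h\<close>.\<close>

lemma (in hopf_galois_structure) act_faithful:
  assumes "\<And>x. act (h \<otimes>\<^sub>Q x) = 0"
  shows "h = 0"
proof -
  \<comment> \<open>\<open>galois_map\<close> is a \<open>tensor_lift\<close> at each
    \<open>y\<close>; its values on pure tensors and at 0 are known only once the lifted map is
    bilinear.\<close>
  have "bilinearQ (\<lambda>x h. x * act (h \<otimes>\<^sub>Q y))" for y
    unfolding bilinearQ_def
    by (intro conjI allI linearQI)
      (simp_all add: linearQ_add[OF linearQ_act_left] linearQ_scale[OF linearQ_act_left]
        distrib_left distrib_right scaleQ_mult_left scaleQ_mult_right)
  note bil = this
  have "galois_map act (1 \<otimes>\<^sub>Q h) = galois_map act 0"
    by (simp add: galois_map_def tensor_lift_of[OF bil] linearQ_zero[OF linearQ_tensor_lift[OF bil]]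
        assms fun_eq_iff)
  then have "(1 :: 'l) \<otimes>\<^sub>Q h = 0"
    using bij_betw_imp_inj_on[OF galois] by (auto dest: injD)
  then show ?thesis by (simp add: one_tensor_eq_0_iff)
qed

section \<open>Integrality under unimodular row operations\<close>

lemma Ints_of_int_mat_mult_vec:
  fixes c :: "'a::comm_ring_1 vec"
  assumes "U \<in> carrier_mat m k" "c \<in> carrier_vec k" "\<forall>i<k. c $ i \<in> \<int>" "i < m"
  shows "(map_mat of_int U *\<^sub>v c) $ i \<in> \<int>"
  using assms by (auto simp: scalar_prod_def intro!: Ints_sum Ints_mult)

lemma invertible_mat_left_inverse:
  assumes "U \<in> carrier_mat m m" "invertible_mat U"
  obtains V where "V \<in> carrier_mat m m" "V * U = 1\<^sub>m m"
proof -
  obtain V where V: "V * U = 1\<^sub>m (dim_row V)" "U * V = 1\<^sub>m m"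
    using assms unfolding invertible_mat_def inverts_mat_def by auto
  \<comment> \<open>The unfolded equations do not state the shape of \<open>V\<close>; it is read
    off by comparing the column counts of both sides.\<close>
  have "dim_col V = m"
    using arg_cong[OF V(2), of dim_col] by simp
  moreover have "dim_row V = m"
    using arg_cong[OF V(1), of dim_col] assms by simp
  ultimately show thesis
    using V that by auto
qed

text \<open>The integer matrices \<open>U\<close> and its left inverse \<open>V\<close> carry
  \<open>M\<close> times \<open>c\<close> and the zero-padded vector \<open>D\<close> times
  \<open>c\<close> into each other. Integrality thus passes both ways, and applying \<open>V\<close>
  carries vanishing from \<open>D\<close> to \<open>M\<close>.\<close>

lemma reduced_matrix_mult_vec:
  assumes "reduced_matrix n M D" and M: "M \<in> carrier_mat (n\<^sup>2) n" and c: "c \<in> carrier_vec n"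
  shows "(\<forall>i<n\<^sup>2. (M *\<^sub>v c) $ i \<in> \<int>) \<longleftrightarrow> (\<forall>i<n. (D *\<^sub>v c) $ i \<in> \<int>)"
    and "D *\<^sub>v c = 0\<^sub>v n \<Longrightarrow> M *\<^sub>v c = 0\<^sub>v (n\<^sup>2)"
proof -
  obtain U :: "int mat" where D: "D \<in> carrier_mat n n" and U: "U \<in> carrier_mat (n\<^sup>2) (n\<^sup>2)"
    and inv: "invertible_mat U"
    and red: "map_mat rat_of_int U * M = D @\<^sub>r 0\<^sub>m (n\<^sup>2 - n) n"
    using assms(1) unfolding reduced_matrix_def by blast
  obtain V where V: "V \<in> carrier_mat (n\<^sup>2) (n\<^sup>2)" "V * U = 1\<^sub>m (n\<^sup>2)"
    by (rule invertible_mat_left_inverse[OF U inv])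
  \<comment> \<open>Subtraction of naturals truncates; this inequality ensures that \<open>n\<close>
    entries followed by \<open>n\<^sup>2 - n\<close> zeros have total length
    \<open>n\<^sup>2\<close>.\<close>
  have le: "n \<le> n\<^sup>2" by (simp add: power2_eq_square)
  let ?e = "(D *\<^sub>v c) @\<^sub>v 0\<^sub>v (n\<^sup>2 - n)"
  have Mc: "M *\<^sub>v c \<in> carrier_vec (n\<^sup>2)" using M c by auto
  have e: "?e \<in> carrier_vec (n\<^sup>2)"
    using append_carrier_vec[of "D *\<^sub>v c" n "0\<^sub>v (n\<^sup>2 - n)" "n\<^sup>2 - n"] D c le by simp
  have "map_mat rat_of_int U *\<^sub>v (M *\<^sub>v c) = (D @\<^sub>r 0\<^sub>m (n\<^sup>2 - n) n) *\<^sub>v c"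
    unfolding red[symmetric]
    by (rule assoc_mult_mat_vec[symmetric, OF _ M c]) (use U in simp)
  also have "\<dots> = (D *\<^sub>v c) @\<^sub>v (0\<^sub>m (n\<^sup>2 - n) n *\<^sub>v c)"
    by (rule mat_mult_append[OF D zero_carrier_mat c])
  also have "0\<^sub>m (n\<^sup>2 - n) n *\<^sub>v c = 0\<^sub>v (n\<^sup>2 - n)"
    using c by auto
  finally have UMc: "map_mat rat_of_int U *\<^sub>v (M *\<^sub>v c) = ?e" .
  have "map_mat rat_of_int V *\<^sub>v (map_mat rat_of_int U *\<^sub>v (M *\<^sub>v c)) =
      map_mat rat_of_int (V * U) *\<^sub>v (M *\<^sub>v c)"
    unfolding of_int_hom.mat_hom_mult[OF V(1) U]
    by (rule assoc_mult_mat_vec[symmetric, OF _ _ Mc]) (use U V in simp_all)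
  also have "\<dots> = M *\<^sub>v c"
    unfolding V(2) of_int_hom.mat_hom_one using Mc by simp
  finally have MV: "M *\<^sub>v c = map_mat rat_of_int V *\<^sub>v ?e"
    unfolding UMc by simp
  show "D *\<^sub>v c = 0\<^sub>v n \<Longrightarrow> M *\<^sub>v c = 0\<^sub>v (n\<^sup>2)"
  proof -
    assume "D *\<^sub>v c = 0\<^sub>v n"
    then have "?e = 0\<^sub>v (n\<^sup>2)" using le by auto
    then show ?thesis unfolding MV using V(1) by auto
  qed
  have "(\<forall>i<n\<^sup>2. (M *\<^sub>v c) $ i \<in> \<int>) \<longleftrightarrow> (\<forall>i<n\<^sup>2. ?e $ i \<in> \<int>)"
    using Ints_of_int_mat_mult_vec[OF U Mc] Ints_of_int_mat_mult_vec[OF V(1) e]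
    unfolding UMc MV[symmetric] by blast
  also have "\<dots> \<longleftrightarrow> (\<forall>i<n. (D *\<^sub>v c) $ i \<in> \<int>)"
    using D le by (auto simp: index_append_vec(1))
  finally show "(\<forall>i<n\<^sup>2. (M *\<^sub>v c) $ i \<in> \<int>) \<longleftrightarrow> (\<forall>i<n. (D *\<^sub>v c) $ i \<in> \<int>)" .
qed

section \<open>The action matrix and the associated order in coordinates\<close>

lemma mult_add_less_square:
  fixes j k n :: nat
  assumes "j < n" "k < n"
  shows "j * n + k < n\<^sup>2"
proof -
  have "j * n + k < Suc j * n" using assms by simp
  also have "\<dots> \<le> n\<^sup>2" unfolding power2_eq_square using assms by (intro mult_right_mono) auto
  finally show ?thesis .
qed

text \<open>Row \<open>j * n + k\<close> is row \<open>k\<close> of block \<open>j\<close>. Since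
  the tensor product, the action and taking a coordinate are all linear, multiplying by
  \<open>c\<close> replaces the basis elements \<open>w l\<close> by their combination.\<close>

lemma action_matrix_mult_vec:
  assumes "linearQ act" "rat_basis n \<gamma>" "j < n" "k < n"
  shows "(action_matrix act n w \<gamma> *\<^sub>v vec n c) $ (j * n + k) =
    rat_vs.representation (\<gamma> ` {..<n}) (act ((\<Sum>l<n. c l *\<^sub>Q w l) \<otimes>\<^sub>Q \<gamma> j)) (\<gamma> k)"
proof -
  let ?R = "\<lambda>x. rat_vs.representation (\<gamma> ` {..<n}) x (\<gamma> k)"
  have ind: "rat_vs.independent (\<gamma> ` {..<n})" and span: "rat_vs.span (\<gamma> ` {..<n}) = UNIV"
    using assms(2) by (auto simp: rat_basis_def)
  have R: "linearQ ?R"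
    by (rule linearQI) (simp_all add: span rat_vs.representation_add[OF ind]
        rat_vs.representation_scale[OF ind] scaleQ_rat_def)
  have "(action_matrix act n w \<gamma> *\<^sub>v vec n c) $ (j * n + k) =
      (\<Sum>l<n. ?R (act (w l \<otimes>\<^sub>Q \<gamma> j)) * c l)"
    using assms(3,4) mult_add_less_square[OF assms(3,4)]
    by (simp add: action_matrix_def action_block_def scalar_prod_def atLeast0LessThan)
  also have "\<dots> = ?R (act ((\<Sum>l<n. c l *\<^sub>Q w l) \<otimes>\<^sub>Q \<gamma> j))"
    unfolding linearQ_sum[OF linearQ_tensor_left] linearQ_sum[OF assms(1)] linearQ_sum[OF R]
    by (simp add: scaleQ_rat_def mult.commute)
  finally show ?thesis .
qed

lemma all_less_square_iff:
  fixes n :: nat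
  shows "(\<forall>i<n\<^sup>2. P i) \<longleftrightarrow> (\<forall>j<n. \<forall>k<n. P (j * n + k))"
proof (intro iffI allI impI)
  fix j k assume P: "\<forall>i<n\<^sup>2. P i" and jk: "j < n" "k < n"
  show "P (j * n + k)" using P mult_add_less_square[OF jk] by blast
next
  fix i assume P: "\<forall>j<n. \<forall>k<n. P (j * n + k)" and i: "i < n\<^sup>2"
  \<comment> \<open>For \<open>n = 0\<close> the bound on \<open>i mod n\<close> would fail, but
    then no \<open>i\<close> lies below \<open>n\<^sup>2\<close>.\<close>
  then have "0 < n" by (auto intro: Nat.gr0I)
  moreover have "i div n < n" using i by (simp add: less_mult_imp_div_less power2_eq_square)
  ultimately have "P (i div n * n + i mod n)" using P mod_less_divisor by blast
  then show "P i" by simp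
qed

text \<open>It suffices to test \<open>h\<close> on the integral basis: the action is additive in
  its second argument and the order is closed under integral combinations.\<close>

lemma (in module_algebra) mem_associated_order_iff:
  assumes "rat_basis n \<gamma>" "int_basis n \<gamma> \<O>"
  shows "h \<in> associated_order act \<O> \<longleftrightarrow>
    (\<forall>j<n. \<forall>k<n. rat_vs.representation (\<gamma> ` {..<n}) (act (h \<otimes>\<^sub>Q \<gamma> j)) (\<gamma> k) \<in> \<int>)"
proof -
  have span: "int_mod.span (\<gamma> ` {..<n}) = \<O>"
    using assms(2) by (simp add: int_basis_def)
  have "h \<in> associated_order act \<O> \<longleftrightarrow> (\<forall>j<n. act (h \<otimes>\<^sub>Q \<gamma> j) \<in> \<O>)"
    unfolding associated_order_def
  proof safe
    fix j assume *: "\<forall>x\<in>\<O>. act (h \<otimes>\<^sub>Q x) \<in> \<O>" "j < n"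
    then have "\<gamma> j \<in> \<O>" unfolding span[symmetric] by (intro int_mod.span_base) simp
    with * show "act (h \<otimes>\<^sub>Q \<gamma> j) \<in> \<O>" by blast
  next
    fix x assume *: "\<forall>j<n. act (h \<otimes>\<^sub>Q \<gamma> j) \<in> \<O>" and "x \<in> \<O>"
    then obtain z where x: "x = (\<Sum>i<n. of_int (z i) *\<^sub>Q \<gamma> i)"
      using assms(2) unfolding int_basis_iff by blast
    have "act (h \<otimes>\<^sub>Q x) = (\<Sum>i<n. of_int (z i) * act (h \<otimes>\<^sub>Q \<gamma> i))"
      unfolding x linearQ_sum[OF linearQ_act_right] of_int_mult_eq_scaleQ ..
    also have "\<dots> \<in> int_mod.span (\<gamma> ` {..<n})"
      by (intro int_mod.span_sum int_mod.span_scale) (use * span in auto)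
    finally show "act (h \<otimes>\<^sub>Q x) \<in> \<O>"
      unfolding span .
  qed
  then show ?thesis by (simp add: mem_int_basis_iff[OF assms])
qed

section \<open>The integral basis read off from the inverse of the reduced matrix\<close>

theorem proposition3p4:
  fixes comult :: "'h::rat_algebra_1 \<Rightarrow> ('h, 'h) tensor"
    and counit :: "'h \<Rightarrow> rat"
    and antipode :: "'h \<Rightarrow> 'h"
    and act :: "('h, 'l::{field, rat_algebra_1}) tensor \<Rightarrow> 'l"
    and \<O> :: "'l set"
    and n :: nat
    and w :: "nat \<Rightarrow> 'h"
    and \<gamma> :: "nat \<Rightarrow> 'l"
    and D :: "rat mat"
  assumes "finite_dimensionalQ TYPE('l)"
    and "rat_vs.dim (UNIV :: 'l set) = n"
    and "hopf_galois_structure comult counit antipode act"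
    and "int_order \<O>"
    and "rat_basis n w"
    and "int_basis n \<gamma> \<O>"
    and "reduced_matrix n (action_matrix act n w \<gamma>) D"
  shows "int_basis n (\<lambda>i. \<Sum>l<n. (the (mat_inverse D) $$ (l, i)) *\<^sub>Q w l)
           (associated_order act \<O>)"
proof -
  interpret hopf_galois_structure comult counit antipode act by fact
  let ?M = "action_matrix act n w \<gamma>"
  have M: "?M \<in> carrier_mat (n\<^sup>2) n" by (simp add: action_matrix_def)
  have D: "D \<in> carrier_mat n n" using assms(7) by (simp add: reduced_matrix_def)
  have \<gamma>: "rat_basis n \<gamma>" using assms(4,6) by (rule rat_basis_if_int_basis_order)
  note red = reduced_matrix_mult_vec[OF assms(7) M vec_carrier]
  note M_vec = action_matrix_mult_vec[OF act_linear \<gamma>, where w = w]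
  have w0: "c i = 0" if "(\<Sum>l<n. c l *\<^sub>Q w l) = 0" "i < n" for c i
    using assms(5) that unfolding rat_basis_iff by blast

  have "det D \<noteq> 0"
  proof
    assume "det D = 0"
    then obtain u where u: "u \<in> carrier_vec n" "u \<noteq> 0\<^sub>v n" "D *\<^sub>v u = 0\<^sub>v n"
      unfolding det_0_iff_vec_prod_zero_field[OF D] by blast
    \<comment> \<open>The kernel vector is read as the \<open>w\<close>-coordinates of an element
      \<open>?h\<close>. Once \<open>?h\<close> is shown to act as zero, faithfulness and uniqueness
      of coordinates force \<open>u\<close> to vanish.\<close>
    define c where "c = vec_index u"
    have uc: "u = vec n c" using u(1) by (auto simp: c_def)
    let ?h = "\<Sum>l<n. c l *\<^sub>Q w l"
    have "?M *\<^sub>v vec n c = 0\<^sub>v (n\<^sup>2)" using red(2) u(3) uc by simp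
    then have "\<forall>i<n\<^sup>2. (?M *\<^sub>v vec n c) $ i = 0" by simp
    then have "\<forall>j<n. \<forall>k<n. rat_vs.representation (\<gamma> ` {..<n}) (act (?h \<otimes>\<^sub>Q \<gamma> j)) (\<gamma> k) = 0"
      unfolding all_less_square_iff by (simp add: M_vec)
    then have \<gamma>0: "act (?h \<otimes>\<^sub>Q \<gamma> j) = 0" if "j < n" for j
      using sum_representation_rat_basis[OF \<gamma>, of "act (?h \<otimes>\<^sub>Q \<gamma> j)"] that by simp
    have "act (?h \<otimes>\<^sub>Q x) = 0" for x
    proof -
      obtain b where "x = (\<Sum>i<n. b i *\<^sub>Q \<gamma> i)"
        by (rule rat_basis_coordinates[OF \<gamma>])
      then show ?thesis by (simp add: linearQ_sum[OF linearQ_act_right] \<gamma>0)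
    qed
    then have "?h = 0" by (rule act_faithful)
    from w0[OF this] have "u = 0\<^sub>v n" unfolding uc by (intro eq_vecI) simp_all
    with u(2) show False by simp
  qed
  \<comment> \<open>A nonzero determinant makes \<open>D\<close> a unit of the matrix ring, which
    excludes \<open>None\<close>. The value \<open>()\<close> merely instantiates the free parameter
    of the ring record.\<close>
  then obtain E where "mat_inverse D = Some E"
    using mat_inverse(1)[OF D, where b = "()"] det_non_zero_imp_unit[OF D, where b = "()"]
    by blast
  then have the_E: "the (mat_inverse D) = E" and DE: "D * E = 1\<^sub>m n" and ED: "E * D = 1\<^sub>m n"
    and E: "E \<in> carrier_mat n n"
    using mat_inverse(2)[OF D] by auto

  let ?v = "\<lambda>i. \<Sum>l<n. E $$ (l, i) *\<^sub>Q w l"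
  \<comment> \<open>Column \<open>i\<close> of \<open>E\<close> holds the
    \<open>w\<close>-coordinates of \<open>?v i\<close>, so \<open>E\<close> converts
    \<open>?v\<close>-coefficients into \<open>w\<close>-coordinates.\<close>
  have v_sum: "(\<Sum>i<n. q i *\<^sub>Q ?v i) = (\<Sum>l<n. (E *\<^sub>v vec n q) $ l *\<^sub>Q w l)" for q
  proof -
    have "(\<Sum>i<n. q i *\<^sub>Q ?v i) = (\<Sum>l<n. \<Sum>i<n. (q i * E $$ (l, i)) *\<^sub>Q w l)"
      unfolding rat_vs.scale_sum_right by (subst sum.swap) (simp add: scaleQ_scaleQ)
    also have "\<dots> = (\<Sum>l<n. (E *\<^sub>v vec n q) $ l *\<^sub>Q w l)"
      using E by (intro sum.cong)
        (auto simp: scalar_prod_def atLeast0LessThan mult.commute rat_vs.scale_sum_left)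
    finally show ?thesis .
  qed
  have D_E: "D *\<^sub>v (E *\<^sub>v vec n q) = vec n q" for q
    using assoc_mult_mat_vec[OF D E, of "vec n q"] DE by simp
  have E_D: "E *\<^sub>v (D *\<^sub>v vec n q) = vec n q" for q
    using assoc_mult_mat_vec[OF E D, of "vec n q"] ED by simp
  \<comment> \<open>Splitting row indices into block and offset matches the coordinate test for the
    associated order with integrality of \<open>?M\<close> times \<open>c\<close>, which
    \<open>red(1)\<close> exchanges for that of \<open>D\<close> times \<open>c\<close>.\<close>
  have mem_iff: "(\<Sum>l<n. c l *\<^sub>Q w l) \<in> associated_order act \<O> \<longleftrightarrow>
      (\<forall>i<n. (D *\<^sub>v vec n c) $ i \<in> \<int>)" for c
    unfolding mem_associated_order_iff[OF \<gamma> assms(6)] red(1)[symmetric] all_less_square_iff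
    by (simp add: M_vec)

  have "int_basis n ?v (associated_order act \<O>)"
    unfolding int_basis_iff v_sum
  proof (intro conjI allI impI)
    fix z :: "nat \<Rightarrow> int" and i
    let ?z = "vec n (\<lambda>i. of_int (z i)) :: rat vec"
    assume "(\<Sum>l<n. (E *\<^sub>v ?z) $ l *\<^sub>Q w l) = 0" and i: "i < n"
    from w0[OF this(1)] have "E *\<^sub>v ?z = 0\<^sub>v n" using E by (intro eq_vecI) simp_all
    moreover have "D *\<^sub>v 0\<^sub>v n = 0\<^sub>v n" using D by (intro eq_vecI) auto
    \<comment> \<open>Applying \<open>D\<close> to the vanishing coordinate vector recovers the
      integer coefficients.\<close>
    ultimately have "?z = 0\<^sub>v n" using D_E[of "\<lambda>i. of_int (z i)"] by simp
    then have "?z $ i = 0" using i by simp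
    with i show "z i = 0" by simp
  next
    show "range (\<lambda>z. \<Sum>l<n. (E *\<^sub>v vec n (\<lambda>i. of_int (z i))) $ l *\<^sub>Q w l) =
      associated_order act \<O>"
    proof (rule Set.set_eqI)
      fix h
      obtain c where h: "h = (\<Sum>l<n. c l *\<^sub>Q w l)"
        by (rule rat_basis_coordinates[OF assms(5)])
      show "h \<in> range (\<lambda>z. \<Sum>l<n. (E *\<^sub>v vec n (\<lambda>i. of_int (z i))) $ l *\<^sub>Q w l) \<longleftrightarrow>
        h \<in> associated_order act \<O>"
      proof
        assume "h \<in> range (\<lambda>z. \<Sum>l<n. (E *\<^sub>v vec n (\<lambda>i. of_int (z i))) $ l *\<^sub>Q w l)"
        then obtain z :: "nat \<Rightarrow> int"
          where z: "h = (\<Sum>l<n. (E *\<^sub>v vec n (\<lambda>i. of_int (z i))) $ l *\<^sub>Q w l)" by blast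
        \<comment> \<open>\<open>mem_iff\<close> speaks of a vector built from a coefficient
          function; in this form \<open>D\<close> cancels \<open>E\<close> and leaves the integer
          vector.\<close>
        have "vec n (vec_index (E *\<^sub>v vec n (\<lambda>i. of_int (z i)))) = E *\<^sub>v vec n (\<lambda>i. of_int (z i))"
          using E by auto
        then show "h \<in> associated_order act \<O>"
          unfolding z mem_iff by (simp add: D_E)
      next
        assume "h \<in> associated_order act \<O>"
        \<comment> \<open>The required integer coefficients are the entries of \<open>D\<close>
          times \<open>c\<close>; multiplying by \<open>E\<close> gives back
          \<open>c\<close>.\<close>
        then obtain z where "\<forall>i<n. (D *\<^sub>v vec n c) $ i = of_int (z i)"
          unfolding h mem_iff by (rule Ints_family[of n "vec_index (D *\<^sub>v vec n c)"])
        then have "D *\<^sub>v vec n c = vec n (\<lambda>i. of_int (z i))" using D by auto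
        then have "E *\<^sub>v vec n (\<lambda>i. of_int (z i)) = vec n c" using E_D by metis
        then have "h = (\<Sum>l<n. (E *\<^sub>v vec n (\<lambda>i. of_int (z i))) $ l *\<^sub>Q w l)"
          unfolding h by simp
        then show "h \<in> range (\<lambda>z. \<Sum>l<n. (E *\<^sub>v vec n (\<lambda>i. of_int (z i))) $ l *\<^sub>Q w l)" by blast
      qed
    qed
  qed
  then show ?thesis unfolding the_E .
qed

end
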